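(* Let $L$ be a finite lattice. Then there is a bijection between transfer systems on $L$ and triples $(x,\mathcal{R}_1,\mathcal{R}_2)$ where $x\in L$, $\mathcal{R}_1$ is a transfer system on $x_\uparrow^{\mathsf c}$, $\mathcal{R}_2$ is a transfer system on $x_\uparrow$ with minimal fibrant element $x$, and $\mathcal{R}_1,\mathcal{R}_2$ form a restriction closed pair over $L$.
   Context: For a finite meet-semilattice (in particular a finite lattice) $(P,\leqslant)$ a transfer system on $P$ is a partial order $\mathcal{R}$ on the set $P$ such that $x\,\mathcal{R}\,y$ implies $x\leqslant y$, and such that whenever $x\,\mathcal{R}\,y$ and $z\leqslant y$ we have $(x\wedge z)\,\mathcal{R}\,z$. (The empty poset has exactly one transfer system.) For $x$ in a finite lattice $L$, $x_\uparrow=\{y\in L: y\geqslant x\}$, which is a sublattice of $L$, and $x_\uparrow^{\mathsf c}=L\smallsetminus x_\uparrow$, which is a sub-meet-semilattice of $L$ (possibly empty). For a transfer system on a finite lattice with maximum element $m$, an element $y$ is called fibrant if $y\,\mathcal{R}\,m$. The set of fibrant elements has a unique minimal element, called the minimal fibrant element. (The maximum of $x_\uparrow$ is the maximum of $L$.) Transfer systems $\mathcal{R}_1$ on $x_\uparrow^{\mathsf c}$ and $\mathcal{R}_2$ on $x_\uparrow$ form a restriction closed pair over $L$ if the relations forced on $x_\uparrow^{\mathsf c}$ by restricting relations of $\mathcal{R}_2$ belong to $\mathcal{R}_1$: whenever $a\,\mathcal{R}_2\,b$ and $z\in x_\uparrow^{\mathsf c}$ with $z\leqslant b$, we have $(a\wedge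 z)\,\mathcal{R}_1\,z$. Equivalently, the disjoint union $\mathcal{R}_1\amalg\mathcal{R}_2$ (as a set of relations on $L$) is a transfer system on $L$. *)

theory Defs
  imports Main
begin

text \<open>The ambient finite lattice is the whole type. A sub-meet-semilattice is a set \<^term>\<open>P\<close>
  closed under \<^const>\<open>inf\<close>, possibly empty, with the order and meets inherited from the type;
  the definitions below are meant for such \<^term>\<open>P\<close>.\<close>

definition transfer_system_on :: "'a::semilattice_inf set \<Rightarrow> 'a rel \<Rightarrow> bool" where
  "transfer_system_on P R \<longleftrightarrow>
     partial_order_on P R \<and>
     (\<forall>x y. (x, y) \<in> R \<longrightarrow> x \<le> y) \<and>
     (\<forall>x y z. (x, y) \<in> R \<longrightarrow> z \<in> P \<longrightarrow> z \<le> y \<longrightarrow> (inf x z, z) \<in> R)"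

definition fibrant_on :: "'a::order set \<Rightarrow> 'a rel \<Rightarrow> 'a \<Rightarrow> bool" where
  "fibrant_on P R y \<longleftrightarrow> y \<in> P \<and> (\<exists>m\<in>P. (\<forall>z\<in>P. z \<le> m) \<and> (y, m) \<in> R)"

text \<open>Uniqueness of the minimal fibrant element is lemma \<open>minimal_fibrant_on_unique\<close>.\<close>

definition minimal_fibrant_on :: "'a::order set \<Rightarrow> 'a rel \<Rightarrow> 'a \<Rightarrow> bool" where
  "minimal_fibrant_on P R x \<longleftrightarrow>
     fibrant_on P R x \<and> (\<forall>y. fibrant_on P R y \<longrightarrow> y \<le> x \<longrightarrow> y = x)"

definition restriction_closed_pair :: "'a::lattice \<Rightarrow> 'a rel \<Rightarrow> 'a rel \<Rightarrow> bool" where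
  "restriction_closed_pair x R1 R2 \<longleftrightarrow>
     (\<forall>a b z. (a, b) \<in> R2 \<longrightarrow> z \<in> - {x..} \<longrightarrow> z \<le> b \<longrightarrow> (inf a z, z) \<in> R1)"

lemma transfer_system_onD:
  assumes "transfer_system_on P R"
  shows "refl_on P R" "trans R" "antisym R" "R \<subseteq> P \<times> P"
    and "\<And>x y. (x, y) \<in> R \<Longrightarrow> x \<le> y"
    and "\<And>x y z. (x, y) \<in> R \<Longrightarrow> z \<in> P \<Longrightarrow> z \<le> y \<Longrightarrow> (inf x z, z) \<in> R"
  using assms partial_order_onD[of P R] by (auto simp: transfer_system_on_def)

lemma minimal_fibrant_on_unique:
  fixes P :: "'a::semilattice_inf set"
  assumes R: "transfer_system_on P R"
    and x: "minimal_fibrant_on P R x" and y: "minimal_fibrant_on P R y"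
  shows "x = y"
proof -
  obtain m where m: "m \<in> P" "\<And>z. z \<in> P \<Longrightarrow> z \<le> m" "(x, m) \<in> R"
    using x unfolding minimal_fibrant_on_def fibrant_on_def by blast
  obtain m' where m': "m' \<in> P" "\<And>z. z \<in> P \<Longrightarrow> z \<le> m'" "(y, m') \<in> R" "y \<in> P"
    using y unfolding minimal_fibrant_on_def fibrant_on_def by blast
  have "m' = m"
    using m(2)[OF m'(1)] m'(2)[OF m(1)] by (rule order.antisym)
  then have ym: "(y, m) \<in> R" using m'(3) by simp
  have i: "(inf x y, y) \<in> R"
    using transfer_system_onD(6)[OF R m(3) m'(4) m(2)[OF m'(4)]] .
  then have "inf x y \<in> P" "(inf x y, m) \<in> R"
    using transfer_system_onD(2,4)[OF R] ym by (auto dest: transD)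
  then have "fibrant_on P R (inf x y)"
    using m(1,2) unfolding fibrant_on_def by blast
  then have "inf x y = x" "inf x y = y"
    using x y unfolding minimal_fibrant_on_def by simp_all
  then show ?thesis by simp
qed

lemma restriction_closed_pair_iff_transfer_system:
  assumes R1: "transfer_system_on (- {x..}) R1" and R2: "transfer_system_on {x..} R2"
  shows "restriction_closed_pair x R1 R2 \<longleftrightarrow> transfer_system_on UNIV (R1 \<union> R2)"
proof
  note D1 = transfer_system_onD[OF R1] and D2 = transfer_system_onD[OF R2]
  assume pair: "restriction_closed_pair x R1 R2"
  have disj: "b \<noteq> c" if "(a, b) \<in> R1 \<or> (b, a) \<in> R1" "(c, d) \<in> R2 \<or> (d, c) \<in> R2" for a b c d
    using that D1(4) D2(4) by blast
  have "trans (R1 \<union> R2)"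
  proof (rule transI)
    fix a b c assume "(a, b) \<in> R1 \<union> R2" "(b, c) \<in> R1 \<union> R2"
    then consider "(a, b) \<in> R1" "(b, c) \<in> R1" | "(a, b) \<in> R2" "(b, c) \<in> R2"
      using disj by blast
    then show "(a, c) \<in> R1 \<union> R2"
      using transD[OF D1(2)] transD[OF D2(2)] by cases blast+
  qed
  moreover have "antisym (R1 \<union> R2)"
  proof (rule antisymI)
    fix a b assume "(a, b) \<in> R1 \<union> R2" "(b, a) \<in> R1 \<union> R2"
    then show "a = b"
      using D1(5) D2(5) by (meson UnE order.antisym)
  qed
  moreover have "refl (R1 \<union> R2)"
    using D1(1) D2(1) unfolding refl_on_def by auto
  moreover have "(inf a z, z) \<in> R1 \<union> R2" if ab: "(a, b) \<in> R1 \<union> R2" "z \<le> b" for a b z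
  proof (cases "(a, b) \<in> R1")
    case True
    then have "\<not> x \<le> b" using D1(4) by auto
    then have "z \<in> - {x..}" using ab(2) order.trans[of x z b] by auto
    then show ?thesis using D1(6)[OF True] ab(2) by blast
  next
    case False
    then have "(a, b) \<in> R2" using ab by blast
    then show ?thesis
      using pair D2(6) ab(2) unfolding restriction_closed_pair_def by blast
  qed
  ultimately show "transfer_system_on UNIV (R1 \<union> R2)"
    unfolding transfer_system_on_def partial_order_on_def preorder_on_def
    by (intro conjI allI impI) (auto dest: D1(5) D2(5))
next
  note D2 = transfer_system_onD[OF R2]
  assume T: "transfer_system_on UNIV (R1 \<union> R2)"
  show "restriction_closed_pair x R1 R2"
    unfolding restriction_closed_pair_def
  proof (intro allI impI)
    fix a b z assume "(a, b) \<in> R2" "z \<in> - {x..}" "z \<le> b"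
    then show "(inf a z, z) \<in> R1"
      using transfer_system_onD(6)[OF T, of a b z] D2(4) by blast
  qed
qed

end

theory Submission
  imports Defs
begin

text \<open>A triple is sent to the union of its two relations. Conversely, if \<open>x\<close> is the minimal
  fibrant element of a transfer system on the lattice, no relation \<open>a \<R> b\<close> leads from outside
  the up-set of \<open>x\<close> into it: restricting along \<open>x \<le> b\<close> shows that the meet of \<open>a\<close> and \<open>x\<close> is
  again fibrant, hence equal to \<open>x\<close> by minimality.\<close>

text \<open>The hypothesis \<open>closed\<close> keeps the restrictions of relations on
  \<open>Q\<close> inside \<open>Q\<close>. It holds both for an up-set, where meets stay above
  \<open>x\<close>, and for its complement, which is closed downwards.\<close>

lemma transfer_system_on_Restr:
  assumes R: "transfer_system_on P R" and "Q \<subseteq> P"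
    and closed: "\<And>a b z. (a, b) \<in> R \<Longrightarrow> a \<in> Q \<Longrightarrow> b \<in> Q \<Longrightarrow> z \<in> Q \<Longrightarrow> z \<le> b \<Longrightarrow> inf a z \<in> Q"
  shows "transfer_system_on Q (R \<inter> Q \<times> Q)"
proof -
  note D = transfer_system_onD[OF R]
  have "refl_on Q (R \<inter> Q \<times> Q)"
    using D(1) \<open>Q \<subseteq> P\<close> unfolding refl_on_def by auto
  moreover have "trans (R \<inter> Q \<times> Q)" "antisym (R \<inter> Q \<times> Q)"
    using D(2,3) by (auto simp: trans_Restr antisym_Restr)
  ultimately show ?thesis
    using D(5,6) \<open>Q \<subseteq> P\<close> closed
    unfolding transfer_system_on_def partial_order_on_def preorder_on_def by blast
qed

lemma ex_minimal_fibrant: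
  assumes R: "transfer_system_on (UNIV :: 'a::{finite,lattice} set) R"
  shows "\<exists>x. minimal_fibrant_on UNIV R x"
proof -
  \<comment> \<open>The type class provides no top element; the join of the finite nonempty type
    supplies the maximum.\<close>
  define m :: 'a where "m = Sup_fin UNIV"
  have "z \<le> m" for z
    unfolding m_def by (rule Sup_fin.coboundedI) simp_all
  moreover have "(m, m) \<in> R"
    using transfer_system_onD(1)[OF R] by (simp add: refl_on_def)
  ultimately have "{y. fibrant_on UNIV R y} \<noteq> {}"
    unfolding fibrant_on_def by blast
  then obtain x where "x \<in> {y. fibrant_on UNIV R y}"
    and "\<forall>y\<in>{y. fibrant_on UNIV R y}. y \<le> x \<longrightarrow> x = y"
    using finite_has_minimal[of "{y. fibrant_on UNIV R y}"] by auto
  then show ?thesis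
    unfolding minimal_fibrant_on_def by auto
qed

lemma minimal_fibrant_on_UNIV_atLeast:
  assumes R: "transfer_system_on (UNIV :: 'a::lattice set) R"
    and x: "minimal_fibrant_on UNIV R x" and ab: "(a, b) \<in> R" "x \<le> b"
  shows "x \<le> a"
proof -
  note D = transfer_system_onD[OF R]
  obtain m where m: "\<And>z. z \<le> m" "(x, m) \<in> R"
    using x unfolding minimal_fibrant_on_def fibrant_on_def by blast
  have "(inf a x, x) \<in> R"
    using D(6)[OF ab(1) UNIV_I ab(2)] .
  then have "(inf a x, m) \<in> R"
    using m(2) D(2) by (auto dest: transD)
  then have "fibrant_on UNIV R (inf a x)"
    using m(1) unfolding fibrant_on_def by blast
  then have "inf a x = x"
    using x unfolding minimal_fibrant_on_def by simp
  then show ?thesis by (metis inf_le1)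
qed

lemma minimal_fibrant_on_Restr:
  fixes x :: "'a::lattice"
  assumes R: "transfer_system_on UNIV R" and x: "minimal_fibrant_on UNIV R x"
  shows "minimal_fibrant_on {x..} (R \<inter> {x..} \<times> {x..}) x"
proof -
  obtain m where m: "\<And>z. z \<le> m" "(x, m) \<in> R"
    using x unfolding minimal_fibrant_on_def fibrant_on_def by blast
  then have "fibrant_on {x..} (R \<inter> {x..} \<times> {x..}) x"
    unfolding fibrant_on_def by auto
  \<comment> \<open>Minimality is automatic for any relation \<open>S\<close>, because
    \<open>x\<close> is the least element of \<open>{x..}\<close>.\<close>
  moreover have "y = x" if "fibrant_on {x..} S y" "y \<le> x" for S y
    using that unfolding fibrant_on_def by (auto intro: order.antisym)
  ultimately show ?thesis
    unfolding minimal_fibrant_on_def by blast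
qed

text \<open>This recovers \<open>x\<close> from the union of the two relations, which makes the map
  on triples injective.\<close>

lemma minimal_fibrant_on_Un:
  fixes x :: "'a::lattice"
  assumes R1: "transfer_system_on (- {x..}) R1" and R2: "transfer_system_on {x..} R2"
    and x: "minimal_fibrant_on {x..} R2 x"
  shows "minimal_fibrant_on UNIV (R1 \<union> R2) x"
proof -
  obtain m where m: "x \<le> m" "\<And>z. x \<le> z \<Longrightarrow> z \<le> m" "(x, m) \<in> R2"
    using x unfolding minimal_fibrant_on_def fibrant_on_def by auto
  \<comment> \<open>The join of \<open>x\<close> and \<open>z\<close> lies in the up-set, so the
    maximum of the up-set also bounds \<open>z\<close>.\<close>
  have top: "z \<le> m" for z
    using m(2)[of "sup x z"] by simp
  then have "fibrant_on UNIV (R1 \<union> R2) x"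
    using m(3) unfolding fibrant_on_def by blast
  moreover have "y = x" if y: "fibrant_on UNIV (R1 \<union> R2) y" "y \<le> x" for y
  proof -
    obtain n where n: "\<And>z. z \<le> n" "(y, n) \<in> R1 \<union> R2"
      using y(1) unfolding fibrant_on_def by blast
    \<comment> \<open>As the maximum, \<open>n\<close> lies above \<open>x\<close>, whereas
      \<open>R1\<close> lives on the complement of the up-set. Hence \<open>y\<close> lies in the
      up-set as well.\<close>
    then have "(y, n) \<in> R2"
      using transfer_system_onD(4)[OF R1] by auto
    then show ?thesis
      using transfer_system_onD(4)[OF R2] y(2) by (auto intro: order.antisym)
  qed
  ultimately show ?thesis
    unfolding minimal_fibrant_on_def by blast
qed

theorem theorem2p8:
  shows "\<exists>f. bij_betw f
    {R :: 'a::{finite,lattice} rel. transfer_system_on UNIV R}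
    {(x :: 'a, R1, R2).
       transfer_system_on (- {x..}) R1 \<and>
       transfer_system_on {x..} R2 \<and>
       minimal_fibrant_on {x..} R2 x \<and>
       restriction_closed_pair x R1 R2}"
proof -
  let ?A = "{R :: 'a rel. transfer_system_on UNIV R}"
  let ?B = "{(x :: 'a, R1, R2). transfer_system_on (- {x..}) R1 \<and> transfer_system_on {x..} R2 \<and>
    minimal_fibrant_on {x..} R2 x \<and> restriction_closed_pair x R1 R2}"
  define g :: "'a \<times> 'a rel \<times> 'a rel \<Rightarrow> 'a rel" where "g = (\<lambda>(x, R1, R2). R1 \<union> R2)"
  have "bij_betw g ?B ?A"
  proof (rule bij_betwI')
    fix s t assume st: "s \<in> ?B" "t \<in> ?B"
    obtain x R1 R2 where s: "s = (x, R1, R2)" by (cases s)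
    obtain y S1 S2 where t: "t = (y, S1, S2)" by (cases t)
    show "g s = g t \<longleftrightarrow> s = t"
    proof
      assume "g s = g t"
      then have eq: "R1 \<union> R2 = S1 \<union> S2" by (simp add: g_def s t)
      have R: "transfer_system_on (- {x..}) R1" "transfer_system_on {x..} R2"
        "minimal_fibrant_on {x..} R2 x" "restriction_closed_pair x R1 R2"
        and S: "transfer_system_on (- {y..}) S1" "transfer_system_on {y..} S2"
        "minimal_fibrant_on {y..} S2 y"
        using st s t by auto
      have "transfer_system_on UNIV (R1 \<union> R2)"
        using restriction_closed_pair_iff_transfer_system[OF R(1,2)] R(4) by blast
      then have "x = y"
        using minimal_fibrant_on_Un[OF R(1-3)] minimal_fibrant_on_Un[OF S]
        unfolding eq by (rule minimal_fibrant_on_unique)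
      note sub = transfer_system_onD(4)[OF R(1)] transfer_system_onD(4)[OF R(2)]
        transfer_system_onD(4)[OF S(1)] transfer_system_onD(4)[OF S(2)]
      \<comment> \<open>Once \<open>x = y\<close>, both unions are split along the same disjoint
        pieces, so their parts agree.\<close>
      have "R1 = S1" "R2 = S2"
        using eq sub unfolding \<open>x = y\<close> by blast+
      with \<open>x = y\<close> show "s = t" by (simp add: s t)
    qed simp
  next
    fix s assume "s \<in> ?B"
    then show "g s \<in> ?A"
      using restriction_closed_pair_iff_transfer_system by (auto simp: g_def)
  next
    fix R assume "R \<in> ?A"
    then have R: "transfer_system_on UNIV R" by simp
    obtain x where x: "minimal_fibrant_on UNIV R x"
      using ex_minimal_fibrant[OF R] by blast
    define R1 where "R1 = R \<inter> (- {x..}) \<times> (- {x..})"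
    define R2 where "R2 = R \<inter> {x..} \<times> {x..}"
    have split: "R = R1 \<union> R2"
    proof -
      \<comment> \<open>No pair of \<open>R\<close> crosses the boundary of the up-set: upwards by
        minimality of \<open>x\<close>, and downwards because related elements are
        comparable.\<close>
      have "x \<le> a \<longleftrightarrow> x \<le> b" if "(a, b) \<in> R" for a b
        using minimal_fibrant_on_UNIV_atLeast[OF R x that] transfer_system_onD(5)[OF R that]
        by (blast intro: order.trans)
      then show ?thesis unfolding R1_def R2_def by auto
    qed
    have ts: "transfer_system_on (- {x..}) R1" "transfer_system_on {x..} R2"
      unfolding R1_def R2_def by (rule transfer_system_on_Restr[OF R]; simp)+
    then have "restriction_closed_pair x R1 R2"
      using restriction_closed_pair_iff_transfer_system R split by blast
    then have "(x, R1, R2) \<in> ?B"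
      using ts minimal_fibrant_on_Restr[OF R x] by (simp add: R2_def)
    then show "\<exists>s\<in>?B. R = g s"
      using split by (intro bexI[of _ "(x, R1, R2)"]) (simp_all add: g_def)
  qed
  \<comment> \<open>The map \<open>g\<close> starts from triples, so its inverse is the required
    bijection.\<close>
  then show ?thesis
    by (blast intro: bij_betw_inv_into)
qed

end
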